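(* Let $(X,T)$ be a topological dynamical system and let $\mathcal{F}=\{f_n\}_{n\ge1}$ and $\Phi=\{\varphi_n\}_{n\ge1}$ be two asymptotically additive potentials on $X$. Then the map $\alpha\mapsto\Lambda_{\mathcal{F}\mid\Phi}(\alpha)$ is continuous on the interval $[\eta(\Phi),\beta(\Phi)]$.
   Context: $X$ is a compact metric space and $T:X\to X$ is continuous. $\mathcal{M}_T$ denotes the set of $T$-invariant Borel probability measures on $X$ (with the weak$^*$ topology) and $\mathcal{E}_T$ the set of ergodic ones. For $f\in C(X)$, $S_nf=\sum_{i=0}^{n-1}f\circ T^i$. A sequence $\mathcal{F}=\{f_n\}_{n\ge1}\subset C(X)$ is an asymptotically additive potential (AAP) if for every $\xi>0$ there is $f_\xi\in C(X)$ with $\limsup_{n\to\infty}\frac1n\|f_n-S_nf_\xi\|_\infty<\xi$. For $\mu\in\mathcal{M}_T$ the limit $\mathcal{F}_*(\mu)=\lim_{n\to\infty}\frac1n\int f_n\,d\mu$ exists and is finite, and $\mu\mapsto\mathcal{F}_*(\mu)$ is continuous on $\mathcal{M}_T$. Define $\beta(\Phi)=\max\{\Phi_*(\mu):\mu\in\mathcal{M}_T\}$, $\eta(\Phi)=\min\{\Phi_*(\mu):\mu\in\mathcal{M}_T\}$, $\mathcal{M}_T(\Phi,\alpha)=\{\mu\in\mathcal{M}_T:\Phi_*(\mu)=\alpha\}$, and the conditional maximum ergodic average $\Lambda_{\mathcal{F}\mid\Phi}(\alpha)=\sup\{\mathcal{F}_*(\mu):\mu\in\mathcal{M}_T(\Phi,\alpha)\}$.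 *)

theory Defs
  imports "HOL-Probability.Probability"
begin

definition birkhoff_sum :: "('a \<Rightarrow> 'a) \<Rightarrow> nat \<Rightarrow> ('a \<Rightarrow> real) \<Rightarrow> 'a \<Rightarrow> real" where
  "birkhoff_sum T n g x = (\<Sum>i<n. g ((T ^^ i) x))"

definition sup_norm_on :: "'a set \<Rightarrow> ('a \<Rightarrow> real) \<Rightarrow> real" where
  "sup_norm_on X h = (SUP x\<in>X. \<bar>h x\<bar>)"

definition invariant_measures :: "'a::metric_space set \<Rightarrow> ('a \<Rightarrow> 'a) \<Rightarrow> 'a measure set" where
  "invariant_measures X T = {\<mu>. space \<mu> = X \<and> sets \<mu> = sets (restrict_space borel X)
      \<and> prob_space \<mu> \<and> T \<in> measurable \<mu> \<mu> \<and> distr \<mu> \<mu> T = \<mu>}"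

definition AAP :: "'a::metric_space set \<Rightarrow> ('a \<Rightarrow> 'a) \<Rightarrow> (nat \<Rightarrow> 'a \<Rightarrow> real) \<Rightarrow> bool" where
  "AAP X T F \<longleftrightarrow> (\<forall>n. continuous_on X (F n)) \<and>
     (\<forall>\<xi>>0. \<exists>g. continuous_on X g \<and>
        limsup (\<lambda>n. ereal (sup_norm_on X (\<lambda>x. F n x - birkhoff_sum T n g x) / real n)) < ereal \<xi>)"

definition pot_star :: "(nat \<Rightarrow> 'a \<Rightarrow> real) \<Rightarrow> 'a measure \<Rightarrow> real" where
  "pot_star F \<mu> = lim (\<lambda>n. (\<integral>x. F n x \<partial>\<mu>) / real n)"

definition beta_pot :: "'a::metric_space set \<Rightarrow> ('a \<Rightarrow> 'a) \<Rightarrow> (nat \<Rightarrow> 'a \<Rightarrow> real) \<Rightarrow> real" where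
  "beta_pot X T \<Phi> = Sup (pot_star \<Phi> ` invariant_measures X T)"

definition eta_pot :: "'a::metric_space set \<Rightarrow> ('a \<Rightarrow> 'a) \<Rightarrow> (nat \<Rightarrow> 'a \<Rightarrow> real) \<Rightarrow> real" where
  "eta_pot X T \<Phi> = Inf (pot_star \<Phi> ` invariant_measures X T)"

definition level_measures :: "'a::metric_space set \<Rightarrow> ('a \<Rightarrow> 'a) \<Rightarrow> (nat \<Rightarrow> 'a \<Rightarrow> real) \<Rightarrow> real \<Rightarrow> 'a measure set" where
  "level_measures X T \<Phi> \<alpha> = {\<mu> \<in> invariant_measures X T. pot_star \<Phi> \<mu> = \<alpha>}"

definition cond_max_avg :: "'a::metric_space set \<Rightarrow> ('a \<Rightarrow> 'a) \<Rightarrow> (nat \<Rightarrow> 'a \<Rightarrow> real) \<Rightarrow> (nat \<Rightarrow> 'a \<Rightarrow> real) \<Rightarrow> real \<Rightarrow> real" where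
  "cond_max_avg X T F \<Phi> \<alpha> = Sup (pot_star F ` level_measures X T \<Phi> \<alpha>)"

end

theory Submission
  imports Defs
begin

text \<open>
  The pairs \<open>(\<Phi>\<^sub>*(\<mu>), F\<^sub>*(\<mu>))\<close> of invariant measures form a compact convex subset of the plane, and
  the conditional maximum ergodic average is its upper boundary function, which is continuous:
  closedness gives upper semicontinuity, and the chords to the two end points give lower
  semicontinuity.

  Compactness rests on weak sequential compactness of the probability measures on \<open>X\<close>. A Borel
  injection \<open>s : X \<rightarrow> [0, 3/2]\<close> is obtained by writing the indicators of countably many balls as
  ternary digits. Digits cannot be cancelled by later ones, so the inverse of \<open>s\<close> is uniformly
  continuous and extends to the closure of the range. Measures are pushed to the line by \<open>s\<close>, Helly's
  theorem yields a limit, and the extended inverse carries it back to \<open>X\<close>.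
\<close>

section \<open>Coding a compact metric space by real numbers\<close>

text \<open>At the first index \<open>m\<close> of disagreement the difference series has a term of
  size \<open>(1/3)^m\<close>, while all later terms together amount to at most
  \<open>(1/3)^(m+1) * 3/2\<close>, which is half of that. The other half survives, and
  \<open>m\<close> is at most \<open>N\<close>.\<close>

lemma ternary_code_diff_ge:
  fixes P Q :: "nat \<Rightarrow> bool"
  assumes "P n \<noteq> Q n" "n \<le> N"
  shows "\<bar>(\<Sum>k. of_bool (P k) * (1/3)^k) - (\<Sum>k. of_bool (Q k) * (1/3)^k)\<bar> \<ge> (1/3)^N / (2::real)"
proof -
  define d :: "nat \<Rightarrow> real" where "d k = (of_bool (P k) - of_bool (Q k)) * (1/3)^k" for k
  define m where "m = (LEAST k. P k \<noteq> Q k)"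
  have m: "P m \<noteq> Q m" "m \<le> n"
    unfolding m_def using assms(1) by (rule LeastI, rule Least_le)
  have "P k = Q k" if "k < m" for k
    using not_less_Least that unfolding m_def by blast
  then have d_less: "(\<Sum>k<m. d k) = 0"
    by (simp add: d_def)
  have geo: "summable (\<lambda>k. (1/3::real)^k)"
    by simp
  have summable_code: "summable (\<lambda>k. of_bool (R k) * (1/3::real)^k)" for R :: "nat \<Rightarrow> bool"
    by (rule summable_comparison_test'[OF geo]) (auto simp: of_bool_def)
  have d_le: "\<bar>d k\<bar> \<le> (1/3)^k" for k
    by (auto simp: d_def of_bool_def)
  have sum_d: "summable d"
    by (rule summable_comparison_test'[OF geo]) (use d_le in simp)
  have tail: "\<bar>\<Sum>k. d (k + Suc m)\<bar> \<le> (1/3)^m / 2"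
  proof -
    have geo': "summable (\<lambda>k. (1/3::real)^(k + Suc m))"
      using geo summable_iff_shift by blast
    have *: "summable (\<lambda>k. \<bar>d (k + Suc m)\<bar>)"
      by (rule summable_comparison_test'[OF geo']) (use d_le[of "_ + Suc m"] in simp)
    have "\<bar>\<Sum>k. d (k + Suc m)\<bar> \<le> (\<Sum>k. \<bar>d (k + Suc m)\<bar>)"
      using * by (rule summable_rabs)
    also have "\<dots> \<le> (\<Sum>k. (1/3)^(k + Suc m))"
      using d_le * geo' by (intro suminf_le)
    also have "\<dots> = (\<Sum>k. (1/3)^k) * (1/3)^Suc m"
      by (simp only: power_add suminf_mult2[OF geo])
    also have "\<dots> = (1/3)^m / 2"
      by (simp add: suminf_geometric)
    finally show ?thesis .
  qed
  have "(\<Sum>k. of_bool (P k) * (1/3)^k) - (\<Sum>k. of_bool (Q k) * (1/3)^k) = suminf d"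
    unfolding d_def by (simp add: suminf_diff[OF summable_code summable_code] left_diff_distrib)
  also have "\<dots> = (\<Sum>k. d (k + Suc m)) + d m"
    using suminf_split_initial_segment[OF sum_d, of "Suc m"] d_less by simp
  finally have eq: "(\<Sum>k. of_bool (P k) * (1/3)^k) - (\<Sum>k. of_bool (Q k) * (1/3)^k)
    = (\<Sum>k. d (k + Suc m)) + d m" .
  have "\<bar>d m\<bar> = (1/3)^m"
    using m(1) by (auto simp: d_def of_bool_def)
  moreover have "(1/3::real)^N \<le> (1/3)^m"
    using m(2) assms(2) by (intro power_decreasing) auto
  ultimately show ?thesis
    using tail unfolding eq by linarith
qed

lemma ternary_code_bounds:
  "(\<Sum>k. of_bool (P k) * (1/3)^k) \<in> {0..3/2::real}"
proof -
  have geo: "summable (\<lambda>k. (1/3::real)^k)"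
    by simp
  have s: "summable (\<lambda>k. of_bool (P k) * (1/3::real)^k)"
    by (rule summable_comparison_test'[OF geo]) (auto simp: of_bool_def)
  have "(\<Sum>k. of_bool (P k) * (1/3)^k) \<le> (\<Sum>k. (1/3::real)^k)"
    by (rule suminf_le[OF _ s geo]) (auto simp: of_bool_def)
  also have "\<dots> = 3/2"
    by (simp add: suminf_geometric)
  finally show ?thesis
    using suminf_nonneg[OF s] by simp
qed

text \<open>At each scale, total boundedness gives a finite cover by balls. Once the enumeration has
  listed all balls of one scale, two points with the same memberships so far share a ball of that
  radius and are therefore close.\<close>

lemma compact_separating_open_sets:
  fixes X :: "'a::metric_space set"
  assumes "compact X"
  obtains A :: "nat \<Rightarrow> 'a set" where "\<And>n. open (A n)"
    "\<And>e. e > 0 \<Longrightarrow> \<exists>N. \<forall>x\<in>X. \<forall>y\<in>X. (\<forall>n\<le>N. x \<in> A n \<longleftrightarrow> y \<in> A n) \<longrightarrow> dist x y < e"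
proof -
  have "\<forall>\<epsilon>>0. \<exists>k. finite k \<and> k \<subseteq> X \<and> X \<subseteq> (\<Union>x\<in>k. ball x \<epsilon>)"
    using assms compact_imp_seq_compact seq_compact_imp_totally_bounded by blast
  then have "\<forall>m::nat. \<exists>k. finite k \<and> X \<subseteq> (\<Union>x\<in>k. ball x (1 / Suc m))"
    by (metis of_nat_0_less_iff zero_less_Suc zero_less_divide_1_iff)
  then obtain K where K: "\<And>m::nat. finite (K m)" "\<And>m. X \<subseteq> (\<Union>x\<in>K m. ball x (1 / Suc m))"
    by metis
  define U where "U m = (\<lambda>c. ball c (1 / Suc m)) ` K m" for m :: nat
  \<comment> \<open>The empty set is added so that \<open>from_nat_into\<close> enumerates a
    nonempty family even when all covers are empty.\<close>
  define V where "V = insert {} (\<Union>m. U m)"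
  have V: "countable V" "V \<noteq> {}"
    using K(1) unfolding V_def U_def by (simp_all add: countable_finite)
  have "open (from_nat_into V n)" for n
    using from_nat_into[OF V(2), of n] by (auto simp: V_def U_def)
  moreover have "\<exists>N. \<forall>x\<in>X. \<forall>y\<in>X. (\<forall>n\<le>N. x \<in> from_nat_into V n \<longleftrightarrow> y \<in> from_nat_into V n) \<longrightarrow> dist x y < e"
    if e: "e > 0" for e
  proof -
    obtain m where m: "1 / Suc m < e / 2"
      using e nat_approx_posE half_gt_zero by blast
    define N where "N = Max (to_nat_on V ` U m)"
    have "dist x y < e" if xy: "x \<in> X" "y \<in> X"
      and eq: "\<forall>n\<le>N. x \<in> from_nat_into V n \<longleftrightarrow> y \<in> from_nat_into V n" for x y
    proof -
      obtain c where c: "c \<in> K m" "x \<in> ball c (1 / Suc m)"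
        using K(2) xy by blast
      then have B: "ball c (1 / Suc m) \<in> U m" "ball c (1 / Suc m) \<in> V"
        by (auto simp: U_def V_def)
      then have "to_nat_on V (ball c (1 / Suc m)) \<le> N"
        using K(1) by (auto simp: N_def U_def)
      then have "y \<in> ball c (1 / Suc m)"
        using eq c(2) from_nat_into_to_nat_on[OF V(1) B(2)] by metis
      then show ?thesis
        using c(2) m dist_triangle_half_r[of c x e y] by (auto simp: dist_commute)
    qed
    then show ?thesis
      by blast
  qed
  ultimately show thesis
    by (rule that)
qed

text \<open>The map \<open>s\<close> is only Borel; no continuity is claimed. What matters is the
  last property, which makes the inverse of \<open>s\<close> uniformly continuous on the codes. It
  holds because codes closer than \<open>(1/3)^N / 2\<close> have the same digits up to
  \<open>N\<close>, hence come from points with the same memberships up to \<open>N\<close>.\<close>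

lemma compact_real_code:
  fixes X :: "'a::metric_space set"
  assumes "compact X"
  obtains s :: "'a \<Rightarrow> real" where "s \<in> borel_measurable borel" "range s \<subseteq> {0..3/2}"
    "\<And>e. e > 0 \<Longrightarrow> \<exists>d>0. \<forall>x\<in>X. \<forall>y\<in>X. \<bar>s x - s y\<bar> < d \<longrightarrow> dist x y < e"
proof -
  obtain A :: "nat \<Rightarrow> 'a set" where A: "\<And>n. open (A n)"
    "\<And>e. e > 0 \<Longrightarrow> \<exists>N. \<forall>x\<in>X. \<forall>y\<in>X. (\<forall>n\<le>N. x \<in> A n \<longleftrightarrow> y \<in> A n) \<longrightarrow> dist x y < e"
    using compact_separating_open_sets[OF assms] by blast
  define s where "s x = (\<Sum>n. of_bool (x \<in> A n) * (1/3)^n :: real)" for x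
  have [measurable]: "A n \<in> sets borel" for n
    using A(1) by simp
  have "s \<in> borel_measurable borel"
    unfolding s_def of_bool_def by measurable
  moreover have "range s \<subseteq> {0..3/2}"
    unfolding s_def using ternary_code_bounds by (intro image_subsetI)
  moreover have "\<exists>d>0. \<forall>x\<in>X. \<forall>y\<in>X. \<bar>s x - s y\<bar> < d \<longrightarrow> dist x y < e" if "e > 0" for e
  proof -
    obtain N where N: "\<forall>x\<in>X. \<forall>y\<in>X. (\<forall>n\<le>N. x \<in> A n \<longleftrightarrow> y \<in> A n) \<longrightarrow> dist x y < e"
      using A(2)[OF \<open>e > 0\<close>] by blast
    have "dist x y < e" if "x \<in> X" "y \<in> X" "\<bar>s x - s y\<bar> < (1/3)^N / 2" for x y
    proof -
      have "x \<in> A n \<longleftrightarrow> y \<in> A n" if "n \<le> N" for n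
        using ternary_code_diff_ge[of "\<lambda>n. x \<in> A n" n "\<lambda>n. y \<in> A n" N]
          that \<open>\<bar>s x - s y\<bar> < (1/3)^N / 2\<close> unfolding s_def by linarith
      then show ?thesis
        using N that by simp
    qed
    then show ?thesis
      by (intro exI[of _ "(1/3)^N / 2"]) auto
  qed
  ultimately show thesis
    by (rule that)
qed

text \<open>A uniformly continuous map into a complete space extends to the closure of its domain.
  Here the map is the inverse of \<open>s\<close> on its range, and compactness of \<open>X\<close>
  supplies the limits.\<close>

lemma continuous_left_inverse_on_closure:
  fixes X :: "'a::metric_space set" and s :: "'a \<Rightarrow> real"
  assumes "compact X"
    and sep: "\<And>e. e > 0 \<Longrightarrow> \<exists>d>0. \<forall>x\<in>X. \<forall>y\<in>X. \<bar>s x - s y\<bar> < d \<longrightarrow> dist x y < e"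
  obtains g where "continuous_on (closure (s ` X)) g" "g ` closure (s ` X) \<subseteq> X"
    "\<And>x. x \<in> X \<Longrightarrow> g (s x) = x"
proof -
  \<comment> \<open>Since \<open>s\<close> may be discontinuous, the limit \<open>t\<close> of the
    codes need not be the code of the limit point \<open>x\<close>, so both limits are
    recorded.\<close>
  define L where "L t x u \<longleftrightarrow> x \<in> X \<and> (\<forall>k::nat. u k \<in> X) \<and> u \<longlonglongrightarrow> x \<and> (\<lambda>k. s (u k)) \<longlonglongrightarrow> t" for t x u
  have ex: "\<exists>x u. L t x u" if t: "t \<in> closure (s ` X)" for t
  proof -
    obtain v where v: "\<And>k. v k \<in> s ` X" "v \<longlonglongrightarrow> t"
      using t unfolding closure_sequential by blast
    then have "\<forall>k. \<exists>x\<in>X. v k = s x"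
      by blast
    then obtain u where u: "\<And>k. u k \<in> X" "\<And>k. v k = s (u k)"
      by metis
    obtain x r where "x \<in> X" "strict_mono (r :: nat \<Rightarrow> nat)" "(u \<circ> r) \<longlonglongrightarrow> x"
      using assms(1) u(1) unfolding compact_def by blast
    moreover have "(v \<circ> r) \<longlonglongrightarrow> t"
      using v(2) \<open>strict_mono r\<close> LIMSEQ_subseq_LIMSEQ by blast
    ultimately have "L t x (u \<circ> r)"
      using u by (auto simp: L_def comp_def)
    then show ?thesis
      by blast
  qed
  \<comment> \<open>For \<open>t = t'\<close> this shows that \<open>x\<close> is determined by
    \<open>t\<close>, so the choice in \<open>g\<close> below is harmless; for \<open>t\<close> near
    \<open>t'\<close> it is uniform continuity of \<open>g\<close>.\<close>
  have close: "\<exists>d>0. \<forall>t t' x x' u u'. L t x u \<longrightarrow> L t' x' u' \<longrightarrow> \<bar>t - t'\<bar> < d \<longrightarrow> dist x x' \<le> e"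
    if e: "e > 0" for e
  proof -
    obtain d where d: "d > 0" "\<And>x y. x \<in> X \<Longrightarrow> y \<in> X \<Longrightarrow> \<bar>s x - s y\<bar> < d \<Longrightarrow> dist x y < e"
      using sep[OF e] by blast
    have "dist x x' \<le> e" if L: "L t x u" "L t' x' u'" and tt: "\<bar>t - t'\<bar> < d" for t t' x x' u u'
    proof -
      have "(\<lambda>k. \<bar>s (u k) - s (u' k)\<bar>) \<longlonglongrightarrow> \<bar>t - t'\<bar>"
        using L unfolding L_def by (intro tendsto_intros) auto
      then have "\<forall>\<^sub>F k in sequentially. \<bar>s (u k) - s (u' k)\<bar> < d"
        using tt order_tendstoD(2) by blast
      then have "\<forall>\<^sub>F k in sequentially. dist (u k) (u' k) \<le> e"
        by eventually_elim (use L d(2) in \<open>auto simp: L_def less_imp_le\<close>)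
      moreover have "(\<lambda>k. dist (u k) (u' k)) \<longlonglongrightarrow> dist x x'"
        using L unfolding L_def by (intro tendsto_intros) auto
      ultimately show ?thesis
        using tendsto_upperbound by fastforce
    qed
    with d(1) show ?thesis
      by blast
  qed
  define g where "g t = (SOME x. \<exists>u. L t x u)" for t
  have g: "\<exists>u. L t (g t) u" if "t \<in> closure (s ` X)" for t
    unfolding g_def using someI_ex[OF ex[OF that]] .
  have "continuous_on (closure (s ` X)) g"
    unfolding continuous_on_iff
  proof (intro ballI allI impI)
    fix t e :: real assume t: "t \<in> closure (s ` X)" and "e > 0"
    then obtain d where d: "d > 0"
      "\<forall>t t' x x' u u'. L t x u \<longrightarrow> L t' x' u' \<longrightarrow> \<bar>t - t'\<bar> < d \<longrightarrow> dist x x' \<le> e / 2"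
      using close[of "e / 2"] by auto
    have "dist (g t') (g t) < e" if "t' \<in> closure (s ` X)" "dist t' t < d" for t'
    proof -
      have "dist (g t') (g t) \<le> e / 2"
        using d(2) g[OF that(1)] g[OF t] that(2) by (metis dist_real_def)
      then show ?thesis
        using \<open>e > 0\<close> by simp
    qed
    then show "\<exists>d>0. \<forall>x'\<in>closure (s ` X). dist x' t < d \<longrightarrow> dist (g x') (g t) < e"
      using d(1) by blast
  qed
  moreover have "g ` closure (s ` X) \<subseteq> X"
    using g unfolding L_def by blast
  \<comment> \<open>The constant sequence at \<open>x\<close> is one witness for the code
    \<open>s x\<close>, the sequence behind \<open>g (s x)\<close> is another, and
    \<open>close\<close> identifies their limits.\<close>
  moreover have "g (s x) = x" if "x \<in> X" for x
  proof -
    have "L (s x) x (\<lambda>_. x)"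
      using that by (simp add: L_def)
    moreover have "s x \<in> closure (s ` X)"
      using that closure_subset[of "s ` X"] by auto
    then obtain u where "L (s x) (g (s x)) u"
      using g by meson
    ultimately have le: "dist (g (s x)) x \<le> e" if "e > 0" for e
    proof -
      have "\<bar>s x - s x\<bar> < d" if "d > 0" for d
        using that by simp
      with close[OF that] \<open>L (s x) x (\<lambda>_. x)\<close> \<open>L (s x) (g (s x)) u\<close> show ?thesis
        by blast
    qed
    have "dist (g (s x)) x \<le> 0"
      by (rule field_le_epsilon) (use le in simp)
    then show ?thesis
      by simp
  qed
  ultimately show thesis
    by (rule that)
qed

section \<open>Weak convergence of probability measures\<close>

text \<open>The counterpart of \<open>invariant_measures\<close> before a map enters; weak
  compactness and mixtures are settled here first, and invariance is added afterwards.\<close>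

definition borel_probs :: "'a::metric_space set \<Rightarrow> 'a measure set" where
  "borel_probs X = {M. prob_space M \<and> sets M = sets (restrict_space borel X)}"

lemma borel_probsD:
  assumes "M \<in> borel_probs X"
  shows "prob_space M" "sets M = sets (restrict_space borel X)" "space M = X"
  using assms sets_eq_imp_space_eq[of M "restrict_space borel X"]
  by (auto simp: borel_probs_def space_restrict_space)

lemma measurable_borel_probs:
  assumes "M \<in> borel_probs X" "f \<in> measurable (restrict_space borel X) N"
  shows "f \<in> measurable M N"
  using assms(2) measurable_cong_sets[OF borel_probsD(2)[OF assms(1)] refl] by blast

lemma continuous_imp_measurable_borel_probs:
  assumes "M \<in> borel_probs X" "continuous_on X f"
  shows "f \<in> borel_measurable M"
  using assms borel_measurable_continuous_on_restrict measurable_borel_probs by blast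

lemma continuous_on_compact_abs_bound:
  fixes f :: "'a::metric_space \<Rightarrow> real"
  assumes "compact X" "continuous_on X f"
  obtains B where "B \<ge> 0" "\<And>x. x \<in> X \<Longrightarrow> \<bar>f x\<bar> \<le> B"
proof -
  have "bounded (f ` X)"
    using assms compact_continuous_image compact_imp_bounded by blast
  then obtain B where "B > 0" "\<forall>y\<in>f ` X. norm y \<le> B"
    unfolding bounded_pos by blast
  then show thesis
    by (intro that[of B]) auto
qed

lemma integrable_continuous_borel_probs:
  fixes f :: "'a::metric_space \<Rightarrow> real"
  assumes "compact X" "M \<in> borel_probs X" "continuous_on X f"
  shows "integrable M f"
proof -
  interpret prob_space M
    using borel_probsD[OF assms(2)] by simp
  obtain B where "\<And>x. x \<in> X \<Longrightarrow> \<bar>f x\<bar> \<le> B"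
    using continuous_on_compact_abs_bound[OF assms(1,3)] by blast
  then show ?thesis
    using borel_probsD(3)[OF assms(2)] continuous_imp_measurable_borel_probs[OF assms(2,3)]
    by (intro integrable_const_bound[of _ B]) auto
qed

text \<open>The closed subsets of \<open>X\<close> form an intersection-stable generator of the
  trace sigma-algebra. The indicator of such a set \<open>A\<close> is the limit of the continuous
  functions \<open>max 0 (1 - n * infdist x A)\<close>, all bounded by 1, so dominated convergence
  makes both measures agree on \<open>A\<close>.\<close>

lemma borel_probs_eqI:
  fixes X :: "'a::metric_space set"
  assumes "closed X" and M: "M \<in> borel_probs X" and N: "N \<in> borel_probs X"
    and eq: "\<And>f::'a \<Rightarrow> real. continuous_on X f \<Longrightarrow> (\<integral>x. f x \<partial>M) = (\<integral>x. f x \<partial>N)"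
  shows "M = N"
proof -
  \<comment> \<open>The set \<open>A\<close> has to be nonempty: by convention
    \<open>infdist x {} = 0\<close>, which would make these functions constantly 1.\<close>
  have conv: "(\<lambda>n. \<integral>x. max 0 (1 - real n * infdist x A) \<partial>P) \<longlonglongrightarrow> measure P A"
    if P: "P \<in> borel_probs X" and A: "closed A" "A \<noteq> {}" "A \<subseteq> X" for P A
  proof -
    interpret prob_space P
      using borel_probsD[OF P] by simp
    have "A \<in> sets (restrict_space borel X)"
      using A by (auto simp: sets_restrict_space)
    then have A': "A \<in> sets P"
      using borel_probsD(2)[OF P] by simp
    have "(\<lambda>n. \<integral>x. max 0 (1 - real n * infdist x A) \<partial>P) \<longlonglongrightarrow> (\<integral>x. indicat_real A x \<partial>P)"
    proof (rule integral_dominated_convergence[where w = "\<lambda>_. 1"])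
      show "(\<lambda>x. max 0 (1 - real n * infdist x A)) \<in> borel_measurable P" for n
        by (intro continuous_imp_measurable_borel_probs[OF P] continuous_intros)
      have "(\<lambda>n. max 0 (1 - real n * infdist x A)) \<longlonglongrightarrow> indicat_real A x" for x
      proof (cases "x \<in> A")
        case False
        then have pos: "infdist x A > 0"
          using A in_closed_iff_infdist_zero infdist_nonneg by (metis less_eq_real_def)
        then obtain m where "1 / infdist x A < real m"
          using reals_Archimedean2 by blast
        then have "max 0 (1 - real n * infdist x A) = 0" if "n \<ge> m" for n
          using that pos by (simp add: divide_less_eq max_def) (smt (verit) mult_right_mono of_nat_le_iff)
        then show ?thesis
          using False by (intro tendsto_eventually) (auto simp: eventually_sequentially)
      qed (simp add: infdist_zero)
      then show "AE x in P. (\<lambda>n. max 0 (1 - real n * infdist x A)) \<longlonglongrightarrow> indicat_real A x"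
        by simp
      show "AE x in P. norm (max 0 (1 - real n * infdist x A)) \<le> 1" for n
        by (simp add: infdist_nonneg)
    qed (use A' in auto)
    then show ?thesis
      using A' sets.sets_into_space[OF A'] by (simp add: Int_absorb2)
  qed
  define E where "E = (\<inter>) X ` {A. closed A}"
  have E: "A \<in> E \<longleftrightarrow> closed A \<and> A \<subseteq> X" for A
    using \<open>closed X\<close> by (auto simp: E_def)
  have "sets (restrict_space borel X) = (\<inter>) X ` sigma_sets UNIV {A. closed A}"
    by (simp add: sets_restrict_space borel_eq_closed)
  also have "\<dots> = sigma_sets X E"
    unfolding E_def by (rule sigma_sets_Int)
      (use \<open>closed X\<close> in \<open>auto intro: sigma_sets.Basic\<close>)
  finally have sets: "sets (restrict_space borel X) = sigma_sets X E" .
  show "M = N"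
  proof (rule measure_eqI_generator_eq[where E = E and \<Omega> = X and A = "\<lambda>_. X"])
    show "Int_stable E"
      by (auto simp: Int_stable_def E)
    show "emeasure M A = emeasure N A" if "A \<in> E" for A
    proof (cases "A = {}")
      case False
      interpret M: prob_space M using borel_probsD[OF M] by simp
      interpret N: prob_space N using borel_probsD[OF N] by simp
      have "(\<lambda>n. \<integral>x. max 0 (1 - real n * infdist x A) \<partial>M) = (\<lambda>n. \<integral>x. max 0 (1 - real n * infdist x A) \<partial>N)"
        by (intro ext eq continuous_intros)
      then have "measure M A = measure N A"
        using conv[OF M, of A] conv[OF N, of A] that False LIMSEQ_unique by (auto simp: E)
      then show ?thesis
        by (simp add: M.emeasure_eq_measure N.emeasure_eq_measure)
    qed simp
    interpret M: prob_space M using borel_probsD[OF M] by simp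
    show "emeasure M X \<noteq> \<infinity>"
      by simp
  qed (use \<open>closed X\<close> sets borel_probsD[OF M] borel_probsD[OF N] in \<open>auto simp: E\<close>)
qed

lemma borel_probs_seq_compact:
  fixes X :: "'a::metric_space set"
  assumes "compact X" and \<mu>: "\<And>k. \<mu> k \<in> borel_probs X"
  obtains r M where "strict_mono (r :: nat \<Rightarrow> nat)" "M \<in> borel_probs X"
    "\<And>f::'a \<Rightarrow> real. continuous_on X f \<Longrightarrow> (\<lambda>k. \<integral>x. f x \<partial>\<mu> (r k)) \<longlonglongrightarrow> (\<integral>x. f x \<partial>M)"
proof -
  obtain s :: "'a \<Rightarrow> real" where s: "s \<in> borel_measurable borel" "range s \<subseteq> {0..3/2}"
    "\<And>e. e > 0 \<Longrightarrow> \<exists>d>0. \<forall>x\<in>X. \<forall>y\<in>X. \<bar>s x - s y\<bar> < d \<longrightarrow> dist x y < e"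
    using compact_real_code[OF assms(1)] by blast
  define C where "C = closure (s ` X)"
  obtain g where g: "continuous_on C g" "g ` C \<subseteq> X" "\<And>x. x \<in> X \<Longrightarrow> g (s x) = x"
    using continuous_left_inverse_on_closure[OF assms(1) s(3)] unfolding C_def by blast
  have sC: "s x \<in> C" if "x \<in> X" for x
    unfolding C_def using that closure_subset[of "s ` X"] by auto
  have "bounded (s ` X)"
    using s(2) by (intro bounded_subset[OF bounded_closed_interval]) auto
  then have "closed C" "compact C"
    by (simp_all add: C_def)
  have "prob_space (\<mu> 0)" "space (\<mu> 0) = X"
    using borel_probsD[OF \<mu>] by auto
  then have "X \<noteq> {}"
    using prob_space.not_empty by blast
  then obtain x0 where x0: "x0 \<in> X"
    by blast
  then have "C \<noteq> {}"
    using sC by blast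
  define \<nu> where "\<nu> k = distr (\<mu> k) borel s" for k
  have s_meas: "s \<in> borel_measurable (\<mu> k)" for k
    using measurable_borel_probs[OF \<mu>] measurable_restrict_space1[OF s(1)] by blast
  have \<nu>: "real_distribution (\<nu> k)" for k
  proof -
    interpret prob_space "\<mu> k"
      using borel_probsD[OF \<mu>] by simp
    show ?thesis
      unfolding \<nu>_def using s_meas by (intro real_distribution.intro prob_space_distr)
        (auto simp: real_distribution_axioms_def)
  qed
  have "tight \<nu>"
    unfolding tight_def
  proof (intro conjI allI impI \<nu>)
    fix \<epsilon> :: real assume "\<epsilon> > 0"
    \<comment> \<open>All codes lie in [0, 3/2], so one half-open interval carries the full mass of
      every image measure.\<close>
    have "measure (\<nu> n) {-1<..2} = 1" for n
    proof -
      interpret prob_space "\<mu> n"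
        using borel_probsD[OF \<mu>] by simp
      have "s x \<in> {-1<..2}" for x
        using s(2) range_subsetD[of s "{0..3/2}" x] by simp
      then have "s -` {-1<..2} \<inter> space (\<mu> n) = space (\<mu> n)"
        by auto
      then show ?thesis
        unfolding \<nu>_def using s_meas by (simp add: measure_distr prob_space)
    qed
    then show "\<exists>a b::real. a < b \<and> (\<forall>n. 1 - \<epsilon> < measure (\<nu> n) {a<..b})"
      using \<open>\<epsilon> > 0\<close> by (intro exI[of _ "-1"] exI[of _ 2]) simp
  qed
  \<comment> \<open>Helly's theorem in this form refines a given subsequence; \<open>id\<close>
    stands for the whole sequence.\<close>
  then obtain r N where r: "strict_mono r" and N: "real_distribution N"
    and conv: "weak_conv_m (\<nu> \<circ> id \<circ> r) N"
    using tight_imp_convergent_subsubsequence[of \<nu> id] by (auto simp: strict_mono_id)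
  interpret N: real_distribution N by fact
  have measurable_N: "f \<in> measurable N L" if "f \<in> measurable borel L" for f :: "real \<Rightarrow> 'z" and L
    using that measurable_cong_sets[OF N.events_eq_borel refl] by blast
  have lim: "(\<lambda>k. \<integral>x. h (s x) \<partial>\<mu> (r k)) \<longlonglongrightarrow> (\<integral>t. h t \<partial>N)"
    if "continuous_on UNIV h" "\<And>t. \<bar>h t\<bar> \<le> B" for h :: "real \<Rightarrow> real" and B
  proof -
    have "(\<lambda>k. integral\<^sup>L ((\<nu> \<circ> id \<circ> r) k) h) \<longlonglongrightarrow> integral\<^sup>L N h"
      by (rule weak_conv_imp_integral_bdd_continuous_conv[OF _ N conv])
        (use that \<nu> in \<open>auto simp: continuous_on_eq_continuous_at\<close>)
    moreover have "integral\<^sup>L (\<nu> k) h = (\<integral>x. h (s x) \<partial>\<mu> k)" for k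
      unfolding \<nu>_def using s_meas that(1)
      by (intro integral_distr) (auto intro: borel_measurable_continuous_onI)
    ultimately show ?thesis
      by simp
  qed
  \<comment> \<open>The test function \<open>min 1 (infdist t C)\<close> is bounded, continuous and
    zero exactly on \<open>C\<close>. Its integrals along the sequence vanish because
    \<open>s\<close> maps \<open>X\<close> into \<open>C\<close>, so the limit measure
    \<open>N\<close> is concentrated on \<open>C\<close>.\<close>
  have "(\<lambda>k. \<integral>x. min 1 (infdist (s x) C) \<partial>\<mu> (r k)) \<longlonglongrightarrow> (\<integral>t. min 1 (infdist t C) \<partial>N)"
    by (rule lim[of "\<lambda>t. min 1 (infdist t C)" 1]) (auto intro!: continuous_intros simp: infdist_nonneg)
  moreover have "(\<integral>x. min 1 (infdist (s x) C) \<partial>\<mu> k) = 0" for k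
  proof -
    have "(\<integral>x. min 1 (infdist (s x) C) \<partial>\<mu> k) = (\<integral>x. 0 \<partial>\<mu> k)"
      by (rule Bochner_Integration.integral_cong) (use sC borel_probsD(3)[OF \<mu>] in auto)
    then show ?thesis
      by simp
  qed
  ultimately have "(\<integral>t. min 1 (infdist t C) \<partial>N) = 0"
    by (simp add: LIMSEQ_const_iff)
  moreover have "integrable N (\<lambda>t. min 1 (infdist t C))"
    by (rule N.integrable_const_bound[of _ 1])
      (auto simp: infdist_nonneg intro!: measurable_N borel_measurable_continuous_onI continuous_intros)
  ultimately have "AE t in N. min 1 (infdist t C) = 0"
    by (subst (asm) integral_nonneg_eq_0_iff_AE) (auto simp: infdist_nonneg)
  then have AE_C: "AE t in N. t \<in> C"
  proof eventually_elim
    case (elim t)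
    then have "infdist t C = 0"
      by (auto simp: min_def split: if_splits)
    then show ?case
      using \<open>closed C\<close> \<open>C \<noteq> {}\<close> in_closed_iff_infdist_zero by blast
  qed
  \<comment> \<open>The inverse \<open>g\<close> is controlled on \<open>C\<close> only. The
    constant \<open>x0\<close> completes it to a Borel map into \<open>X\<close>, altering it only
    on a null set of \<open>N\<close>.\<close>
  define g' where "g' t = (if t \<in> C then g t else x0)" for t
  have g': "g' \<in> measurable N (restrict_space borel X)"
  proof (rule measurable_restrict_space2)
    have "g' \<in> borel_measurable borel"
      unfolding g'_def using \<open>closed C\<close> g(1) by (intro borel_measurable_continuous_on_if) auto
    then show "g' \<in> borel_measurable N"
      by (rule measurable_N)
  qed (use g(2) x0 in \<open>auto simp: g'_def image_subset_iff\<close>)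
  define M where "M = distr N (restrict_space borel X) g'"
  have "M \<in> borel_probs X"
    unfolding borel_probs_def M_def using N.prob_space_distr[OF g'] by simp
  moreover have "(\<lambda>k. \<integral>x. f x \<partial>\<mu> (r k)) \<longlonglongrightarrow> (\<integral>x. f x \<partial>M)"
    if f: "continuous_on X f" for f :: "'a \<Rightarrow> real"
  proof -
    obtain B where B: "B \<ge> 0" "\<And>x. x \<in> X \<Longrightarrow> \<bar>f x\<bar> \<le> B"
      using continuous_on_compact_abs_bound[OF assms(1) f] by blast
    have "continuous_on C (f \<circ> g)"
      using f g(1,2) by (intro continuous_on_compose continuous_on_subset[OF f]) auto
    \<comment> \<open>Weak convergence tests functions on the whole line, so Tietze extends
      \<open>f \<circ> g\<close> from the closed set \<open>C\<close> with the same bound. On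
      \<open>X\<close> one has \<open>h (s x) = f (g (s x)) = f x\<close>, so a discontinuity of
      \<open>s\<close> does no harm.\<close>
    then obtain h where h: "continuous_on UNIV h" "\<And>t. t \<in> C \<Longrightarrow> h t = f (g t)" "\<And>t. norm (h t) \<le> B"
      using Tietze[of C "f \<circ> g" UNIV B] \<open>closed C\<close> B g(2) by (auto simp: image_subset_iff)
    have "(\<integral>x. f x \<partial>M) = (\<integral>t. f (g' t) \<partial>N)"
      unfolding M_def using g' f
      by (intro integral_distr) (auto intro: borel_measurable_continuous_on_restrict)
    also have "\<dots> = (\<integral>t. h t \<partial>N)"
    proof (rule integral_cong_AE)
      show "(\<lambda>t. f (g' t)) \<in> borel_measurable N"
        using measurable_compose[OF g' borel_measurable_continuous_on_restrict[OF f]] .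
      show "h \<in> borel_measurable N"
        using h(1) borel_measurable_continuous_onI measurable_N by blast
      show "AE t in N. f (g' t) = h t"
        using AE_C by eventually_elim (simp add: g'_def h(2))
    qed
    finally have "(\<integral>x. f x \<partial>M) = (\<integral>t. h t \<partial>N)" .
    moreover have "(\<integral>x. h (s x) \<partial>\<mu> k) = (\<integral>x. f x \<partial>\<mu> k)" for k
      by (rule Bochner_Integration.integral_cong)
        (use borel_probsD(3)[OF \<mu>] sC h(2) g(3) in auto)
    ultimately show ?thesis
      using lim[of h B] h by simp
  qed
  ultimately show thesis
    by (rule that[OF r])
qed

text \<open>The convex combination is built as a two-stage experiment: a coin with bias
  \<open>u\<close> selects \<open>M\<close> or \<open>N\<close>, then a point is drawn from the
  selected measure. The integral formula is the Fubini rule for \<open>bind\<close>, and compactness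
  of \<open>X\<close> provides the bound on \<open>f\<close> which that rule asks for.\<close>

lemma borel_probs_mixture:
  assumes M: "M \<in> borel_probs X" and N: "N \<in> borel_probs X" and u: "0 \<le> u" "u \<le> 1" and "compact X"
  obtains P where "P \<in> borel_probs X"
    "\<And>f::'a::metric_space \<Rightarrow> real. continuous_on X f \<Longrightarrow>
      (\<integral>x. f x \<partial>P) = u * (\<integral>x. f x \<partial>M) + (1 - u) * (\<integral>x. f x \<partial>N)"
proof -
  define K where "K b = (if b then M else N)" for b
  let ?B = "measure_pmf (bernoulli_pmf u)" and ?R = "restrict_space borel X"
  have K: "K b \<in> borel_probs X" for b
    using M N by (simp add: K_def)
  have prob_K: "prob_space (K b)" for b
    using borel_probsD(1)[OF K] .
  have meas: "K \<in> measurable ?B (subprob_algebra ?R)"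
    using borel_probsD[OF K] by (auto simp: space_subprob_algebra prob_space_imp_subprob_space)
  define P where "P = ?B \<bind> K"
  have "prob_space P"
    unfolding P_def by (rule measure_pmf.prob_space_bind[OF _ meas]) (simp add: prob_K)
  moreover have "sets P = sets ?R"
    unfolding P_def by (rule sets_bind) (simp_all add: borel_probsD(2)[OF K])
  ultimately have "P \<in> borel_probs X"
    by (simp add: borel_probs_def)
  moreover have "(\<integral>x. f x \<partial>P) = u * (\<integral>x. f x \<partial>M) + (1 - u) * (\<integral>x. f x \<partial>N)"
    if f: "continuous_on X f" for f :: "'a \<Rightarrow> real"
  proof -
    obtain B where B: "\<And>x. x \<in> X \<Longrightarrow> \<bar>f x\<bar> \<le> B"
      using continuous_on_compact_abs_bound[OF \<open>compact X\<close> f] by blast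
    have "(\<integral>x. f x \<partial>P) = (\<integral>b. (\<integral>x. f x \<partial>K b) \<partial>?B)"
      unfolding P_def
    proof (rule integral_bind[OF _ _ meas, where B = B and B' = 1])
      show "f \<in> borel_measurable ?R"
        using f by (rule borel_measurable_continuous_on_restrict)
      show "finite_measure ?B"
        by (rule measure_pmf.finite_measure_axioms)
    qed (auto simp: B space_restrict_space prob_space.emeasure_space_1[OF prob_K])
    then show ?thesis
      using u by (simp add: K_def mult.commute)
  qed
  ultimately show thesis
    by (rule that)
qed

section \<open>Invariant measures and asymptotically additive potentials\<close>

locale compact_system =
  fixes X :: "'a::metric_space set" and T :: "'a \<Rightarrow> 'a"
  assumes compact_X: "compact X" and continuous_T: "continuous_on X T" and T_into: "T ` X \<subseteq> X"
begin

section \<open>Invariance expressed through integrals of continuous functions\<close>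

lemma T_measurable:
  assumes "M \<in> borel_probs X"
  shows "T \<in> measurable M M"
proof -
  have "T \<in> measurable (restrict_space borel X) (restrict_space borel X)"
    using T_into borel_measurable_continuous_on_restrict[OF continuous_T]
    by (intro measurable_restrict_space2) (auto simp: space_restrict_space)
  then show ?thesis
    using borel_probsD(2)[OF assms] measurable_cong_sets by blast
qed

lemma continuous_compose_T: "continuous_on X f \<Longrightarrow> continuous_on X (\<lambda>x. f (T x))"
  using continuous_on_compose2[OF _ continuous_T T_into] .

lemma invariant_measures_borel_probs: "M \<in> invariant_measures X T \<Longrightarrow> M \<in> borel_probs X"
  by (simp add: invariant_measures_def borel_probs_def)

text \<open>The hypothesis says that \<open>M\<close> and its image under \<open>T\<close> have the
  same integrals of continuous functions, so \<open>borel_probs_eqI\<close> identifies them. In this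
  form invariance visibly survives convex combinations and weak limits.\<close>

lemma invariant_measuresI:
  assumes M: "M \<in> borel_probs X"
    and eq: "\<And>f::'a \<Rightarrow> real. continuous_on X f \<Longrightarrow> (\<integral>x. f (T x) \<partial>M) = (\<integral>x. f x \<partial>M)"
  shows "M \<in> invariant_measures X T"
proof -
  interpret prob_space M
    using borel_probsD[OF M] by simp
  have "distr M M T \<in> borel_probs X"
    using prob_space_distr[OF T_measurable[OF M]] borel_probsD[OF M] by (simp add: borel_probs_def)
  moreover have "(\<integral>x. f x \<partial>distr M M T) = (\<integral>x. f x \<partial>M)" if "continuous_on X f" for f :: "'a \<Rightarrow> real"
    using integral_distr[OF T_measurable[OF M] continuous_imp_measurable_borel_probs[OF M that]] eq[OF that]
    by simp
  ultimately have "distr M M T = M"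
    using borel_probs_eqI[OF compact_imp_closed[OF compact_X] _ M] by blast
  then show ?thesis
    using borel_probsD[OF M] T_measurable[OF M] by (simp add: invariant_measures_def)
qed

lemma integral_compose_T:
  fixes f :: "'a \<Rightarrow> real"
  assumes "M \<in> invariant_measures X T" "continuous_on X f"
  shows "(\<integral>x. f (T x) \<partial>M) = (\<integral>x. f x \<partial>M)"
proof -
  have M: "M \<in> borel_probs X" and "distr M M T = M"
    using assms(1) by (simp_all add: invariant_measures_borel_probs) (simp add: invariant_measures_def)
  then show ?thesis
    using integral_distr[OF T_measurable[OF M] continuous_imp_measurable_borel_probs[OF M assms(2)]]
    by simp
qed

lemma integral_birkhoff_sum:
  assumes M: "M \<in> invariant_measures X T" and g: "continuous_on X g"
  shows "continuous_on X (birkhoff_sum T n g)"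
    "(\<integral>x. birkhoff_sum T n g x \<partial>M) = real n * (\<integral>x. g x \<partial>M)"
proof -
  have cont: "continuous_on X (\<lambda>x. g ((T ^^ i) x))" for i
    using g
  proof (induction i)
    case (Suc i)
    then show ?case
      using continuous_compose_T[of "\<lambda>x. g ((T ^^ i) x)"] by (simp add: funpow_swap1)
  qed simp
  then show "continuous_on X (birkhoff_sum T n g)"
    unfolding birkhoff_sum_def by (intro continuous_on_sum)
  have "(\<integral>x. g ((T ^^ i) x) \<partial>M) = (\<integral>x. g x \<partial>M)" for i
  proof (induction i)
    case (Suc i)
    then show ?case
      using integral_compose_T[OF M cont[of i]] by (simp add: funpow_swap1)
  qed simp
  moreover have "integrable M (\<lambda>x. g ((T ^^ i) x))" for i
    using integrable_continuous_borel_probs[OF compact_X invariant_measures_borel_probs[OF M] cont] .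
  ultimately show "(\<integral>x. birkhoff_sum T n g x \<partial>M) = real n * (\<integral>x. g x \<partial>M)"
    unfolding birkhoff_sum_def by (simp add: Bochner_Integration.integral_sum)
qed

lemma invariant_measures_mixture:
  assumes M: "M \<in> invariant_measures X T" and N: "N \<in> invariant_measures X T" and u: "0 \<le> u" "u \<le> 1"
  obtains P where "P \<in> invariant_measures X T"
    "\<And>f::'a \<Rightarrow> real. continuous_on X f \<Longrightarrow>
      (\<integral>x. f x \<partial>P) = u * (\<integral>x. f x \<partial>M) + (1 - u) * (\<integral>x. f x \<partial>N)"
proof -
  obtain P where P: "P \<in> borel_probs X"
    "\<And>f::'a \<Rightarrow> real. continuous_on X f \<Longrightarrow>
      (\<integral>x. f x \<partial>P) = u * (\<integral>x. f x \<partial>M) + (1 - u) * (\<integral>x. f x \<partial>N)"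
    using borel_probs_mixture[OF M[THEN invariant_measures_borel_probs]
      N[THEN invariant_measures_borel_probs] u compact_X] by blast
  have "P \<in> invariant_measures X T"
    using P(1) by (rule invariant_measuresI)
      (simp add: P(2) continuous_compose_T integral_compose_T[OF M] integral_compose_T[OF N])
  then show thesis
    using P(2) by (rule that)
qed

text \<open>Weak convergence may be applied to \<open>f\<close> and also to its composition with
  \<open>T\<close>, which is again continuous; the two limits inherit the equality that holds along
  the sequence.\<close>

lemma invariant_measures_seq_compact:
  assumes \<mu>: "\<And>k. \<mu> k \<in> invariant_measures X T"
  obtains r M where "strict_mono (r :: nat \<Rightarrow> nat)" "M \<in> invariant_measures X T"
    "\<And>f::'a \<Rightarrow> real. continuous_on X f \<Longrightarrow> (\<lambda>k. \<integral>x. f x \<partial>\<mu> (r k)) \<longlonglongrightarrow> (\<integral>x. f x \<partial>M)"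
proof -
  obtain r M where r: "strict_mono (r :: nat \<Rightarrow> nat)" and M: "M \<in> borel_probs X"
    and lim: "\<And>f::'a \<Rightarrow> real. continuous_on X f \<Longrightarrow> (\<lambda>k. \<integral>x. f x \<partial>\<mu> (r k)) \<longlonglongrightarrow> (\<integral>x. f x \<partial>M)"
    by (rule borel_probs_seq_compact[of X \<mu>, OF compact_X invariant_measures_borel_probs[OF \<mu>]]) blast
  have "(\<integral>x. f (T x) \<partial>M) = (\<integral>x. f x \<partial>M)" if f: "continuous_on X f" for f :: "'a \<Rightarrow> real"
    using lim[OF continuous_compose_T[OF f]] lim[OF f] LIMSEQ_unique
    by (simp add: integral_compose_T[OF \<mu> f])
  then have "M \<in> invariant_measures X T"
    by (rule invariant_measuresI[OF M])
  then show thesis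
    using r lim that by blast
qed

section \<open>The limit functional of an asymptotically additive potential\<close>

text \<open>For invariant \<open>M\<close> the Birkhoff sum of \<open>g\<close> integrates to
  \<open>n\<close> times the integral of \<open>g\<close>, so the sup-norm estimate turns into an
  estimate of averages. The point is that \<open>g\<close> and \<open>N\<close> do not depend on
  \<open>M\<close>.\<close>

lemma AAP_uniform_approx:
  assumes F: "AAP X T F" and "\<xi> > 0"
  obtains g N where "continuous_on X g"
    "\<And>n M. n \<ge> N \<Longrightarrow> M \<in> invariant_measures X T \<Longrightarrow> \<bar>(\<integral>x. F n x \<partial>M) / real n - (\<integral>x. g x \<partial>M)\<bar> \<le> \<xi>"
proof -
  have contF: "continuous_on X (F n)" for n
    using F by (simp add: AAP_def)
  obtain g where g: "continuous_on X g"
    and limsup: "limsup (\<lambda>n. ereal (sup_norm_on X (\<lambda>x. F n x - birkhoff_sum T n g x) / real n)) < ereal \<xi>"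
    using F \<open>\<xi> > 0\<close> unfolding AAP_def by blast
  obtain N where N: "\<And>n. n \<ge> N \<Longrightarrow> sup_norm_on X (\<lambda>x. F n x - birkhoff_sum T n g x) / real n < \<xi>"
    using Limsup_lessD[OF limsup] by (auto simp: eventually_sequentially)
  \<comment> \<open>Starting at \<open>Suc N\<close> excludes \<open>n = 0\<close>, where division
    by zero makes the bound on the quotient carry no information.\<close>
  have "\<bar>(\<integral>x. F n x \<partial>M) / real n - (\<integral>x. g x \<partial>M)\<bar> \<le> \<xi>"
    if n: "n \<ge> Suc N" and M: "M \<in> invariant_measures X T" for n M
  proof -
    note MX = invariant_measures_borel_probs[OF M]
    interpret prob_space M
      using borel_probsD[OF MX] by simp
    define h where "h x = F n x - birkhoff_sum T n g x" for x
    have h: "continuous_on X h"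
      unfolding h_def using contF integral_birkhoff_sum(1)[OF M g] by (intro continuous_intros)
    obtain B where "\<And>x. x \<in> X \<Longrightarrow> \<bar>h x\<bar> \<le> B"
      using continuous_on_compact_abs_bound[OF compact_X h] by blast
    then have le: "\<bar>h x\<bar> \<le> sup_norm_on X h" if "x \<in> X" for x
      unfolding sup_norm_on_def using that by (intro cSUP_upper bdd_aboveI2) auto
    have int: "integrable M h"
      using integrable_continuous_borel_probs[OF compact_X MX h] .
    have "\<bar>\<integral>x. h x \<partial>M\<bar> \<le> (\<integral>x. \<bar>h x\<bar> \<partial>M)"
      by (rule integral_abs_bound)
    also have "\<dots> \<le> (\<integral>x. sup_norm_on X h \<partial>M)"
      using int le borel_probsD(3)[OF MX] by (intro integral_mono) auto
    finally have "\<bar>\<integral>x. h x \<partial>M\<bar> \<le> sup_norm_on X h"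
      by (simp add: prob_space)
    moreover have "(\<integral>x. h x \<partial>M) = (\<integral>x. F n x \<partial>M) - real n * (\<integral>x. g x \<partial>M)"
      unfolding h_def using integral_birkhoff_sum[OF M g]
      by (simp add: integrable_continuous_borel_probs[OF compact_X MX] contF)
    moreover have "sup_norm_on X h \<le> \<xi> * real n"
      using N[of n] n unfolding h_def by (simp add: divide_less_eq)
    ultimately have "\<bar>(\<integral>x. F n x \<partial>M) - real n * (\<integral>x. g x \<partial>M)\<bar> \<le> \<xi> * real n"
      by simp
    then have "\<bar>(\<integral>x. F n x \<partial>M) - real n * (\<integral>x. g x \<partial>M)\<bar> / real n \<le> \<xi>"
      using n by (simp add: divide_le_eq)
    also have "\<bar>(\<integral>x. F n x \<partial>M) - real n * (\<integral>x. g x \<partial>M)\<bar> / real n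
        = \<bar>((\<integral>x. F n x \<partial>M) - real n * (\<integral>x. g x \<partial>M)) / real n\<bar>"
      by simp
    also have "\<dots> = \<bar>(\<integral>x. F n x \<partial>M) / real n - (\<integral>x. g x \<partial>M)\<bar>"
      using n by (simp add: diff_divide_distrib)
    finally show ?thesis .
  qed
  with g show thesis
    by (rule that)
qed

text \<open>As \<open>pot_star\<close> is defined by \<open>lim\<close>, it is meaningful only after
  convergence is shown. The averages are Cauchy because from some index on all of them lie within
  \<open>e / 3\<close> of the single number given by the integral of \<open>g\<close>.\<close>

lemma pot_star_LIMSEQ:
  assumes F: "AAP X T F" and M: "M \<in> invariant_measures X T"
  shows "(\<lambda>n. (\<integral>x. F n x \<partial>M) / real n) \<longlonglongrightarrow> pot_star F M"
proof -
  have "Cauchy (\<lambda>n. (\<integral>x. F n x \<partial>M) / real n)"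
    unfolding Cauchy_def
  proof (intro allI impI)
    fix e :: real assume "e > 0"
    then have "e / 3 > 0"
      by simp
    then obtain g N where g: "\<And>n. n \<ge> N \<Longrightarrow> \<bar>(\<integral>x. F n x \<partial>M) / real n - (\<integral>x. g x \<partial>M)\<bar> \<le> e / 3"
      by (rule AAP_uniform_approx[OF F]) (use M that in blast)
    have "dist ((\<integral>x. F m x \<partial>M) / real m) ((\<integral>x. F n x \<partial>M) / real n) < e"
      if "m \<ge> N" "n \<ge> N" for m n
      using g[OF that(1)] g[OF that(2)] \<open>e > 0\<close> unfolding dist_real_def by linarith
    then show "\<exists>N. \<forall>m\<ge>N. \<forall>n\<ge>N. dist ((\<integral>x. F m x \<partial>M) / real m) ((\<integral>x. F n x \<partial>M) / real n) < e"
      by blast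
  qed
  then show ?thesis
    unfolding pot_star_def using Cauchy_convergent convergent_LIMSEQ_iff by blast
qed

text \<open>On invariant measures \<open>pot_star F\<close> is thus a uniform limit of integrals of
  continuous functions, from which it inherits weak continuity.\<close>

lemma pot_star_approx:
  assumes F: "AAP X T F" and "\<xi> > 0"
  obtains g where "continuous_on X g"
    "\<And>M. M \<in> invariant_measures X T \<Longrightarrow> \<bar>pot_star F M - (\<integral>x. g x \<partial>M)\<bar> \<le> \<xi>"
proof -
  obtain g N where g: "continuous_on X g"
    "\<And>n M. n \<ge> N \<Longrightarrow> M \<in> invariant_measures X T \<Longrightarrow> \<bar>(\<integral>x. F n x \<partial>M) / real n - (\<integral>x. g x \<partial>M)\<bar> \<le> \<xi>"
    using AAP_uniform_approx[OF assms] by blast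
  have "\<bar>pot_star F M - (\<integral>x. g x \<partial>M)\<bar> \<le> \<xi>" if M: "M \<in> invariant_measures X T" for M
  proof (rule tendsto_upperbound)
    show "(\<lambda>n. \<bar>(\<integral>x. F n x \<partial>M) / real n - (\<integral>x. g x \<partial>M)\<bar>) \<longlonglongrightarrow> \<bar>pot_star F M - (\<integral>x. g x \<partial>M)\<bar>"
      by (intro tendsto_intros pot_star_LIMSEQ[OF F M])
    show "\<forall>\<^sub>F n in sequentially. \<bar>(\<integral>x. F n x \<partial>M) / real n - (\<integral>x. g x \<partial>M)\<bar> \<le> \<xi>"
      using g(2)[OF _ M] eventually_sequentially by blast
  qed simp
  with g(1) show thesis
    by (rule that)
qed

lemma pot_star_weak_limit:
  assumes F: "AAP X T F" and \<mu>: "\<And>k. \<mu> k \<in> invariant_measures X T" and M: "M \<in> invariant_measures X T"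
    and lim: "\<And>f::'a \<Rightarrow> real. continuous_on X f \<Longrightarrow> (\<lambda>k. \<integral>x. f x \<partial>\<mu> k) \<longlonglongrightarrow> (\<integral>x. f x \<partial>M)"
  shows "(\<lambda>k. pot_star F (\<mu> k)) \<longlonglongrightarrow> pot_star F M"
proof (rule tendstoI)
  fix e :: real assume "e > 0"
  then have "e / 3 > 0"
    by simp
  then obtain g where g: "continuous_on X g"
    "\<And>M. M \<in> invariant_measures X T \<Longrightarrow> \<bar>pot_star F M - (\<integral>x. g x \<partial>M)\<bar> \<le> e / 3"
    using pot_star_approx[OF F] by blast
  have "\<forall>\<^sub>F k in sequentially. dist (\<integral>x. g x \<partial>\<mu> k) (\<integral>x. g x \<partial>M) < e / 3"
    using lim[OF g(1)] \<open>e / 3 > 0\<close> by (rule tendstoD)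
  then show "\<forall>\<^sub>F k in sequentially. dist (pot_star F (\<mu> k)) (pot_star F M) < e"
  proof eventually_elim
    case (elim k)
    then show ?case
      using g(2)[OF \<mu>[of k]] g(2)[OF M] unfolding dist_real_def by linarith
  qed
qed

lemma pot_star_mixture:
  assumes F: "AAP X T F" and M: "M \<in> invariant_measures X T" and N: "N \<in> invariant_measures X T"
    and P: "P \<in> invariant_measures X T"
    and mix: "\<And>f::'a \<Rightarrow> real. continuous_on X f \<Longrightarrow>
      (\<integral>x. f x \<partial>P) = u * (\<integral>x. f x \<partial>M) + (1 - u) * (\<integral>x. f x \<partial>N)"
  shows "pot_star F P = u * pot_star F M + (1 - u) * pot_star F N"
proof (rule LIMSEQ_unique)
  show "(\<lambda>n. (\<integral>x. F n x \<partial>P) / real n) \<longlonglongrightarrow> pot_star F P"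
    by (rule pot_star_LIMSEQ[OF F P])
  have "(\<integral>x. F n x \<partial>P) / real n = u * ((\<integral>x. F n x \<partial>M) / real n) + (1 - u) * ((\<integral>x. F n x \<partial>N) / real n)" for n
    using F by (simp add: AAP_def mix add_divide_distrib)
  then show "(\<lambda>n. (\<integral>x. F n x \<partial>P) / real n) \<longlonglongrightarrow> u * pot_star F M + (1 - u) * pot_star F N"
    by (simp only:) (intro tendsto_intros pot_star_LIMSEQ[OF F M] pot_star_LIMSEQ[OF F N])
qed

section \<open>The planar set of value pairs\<close>

text \<open>The constraint is the first coordinate, so that projecting gives the attainable levels
  and the vertical slice over a level holds the values that compete in
  \<open>cond_max_avg\<close>.\<close>

definition pot_range :: "(nat \<Rightarrow> 'a \<Rightarrow> real) \<Rightarrow> (nat \<Rightarrow> 'a \<Rightarrow> real) \<Rightarrow> (real \<times> real) set" where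
  "pot_range \<Phi> F = (\<lambda>M. (pot_star \<Phi> M, pot_star F M)) ` invariant_measures X T"

text \<open>A single weakly convergent subsequence of measures makes both coordinates converge, by
  \<open>pot_star_weak_limit\<close>.\<close>

lemma compact_pot_range:
  assumes "AAP X T F" "AAP X T \<Phi>"
  shows "compact (pot_range \<Phi> F)"
  unfolding compact_def
proof (intro allI impI)
  fix p :: "nat \<Rightarrow> real \<times> real" assume "\<forall>k. p k \<in> pot_range \<Phi> F"
  then have "\<forall>k. \<exists>M\<in>invariant_measures X T. p k = (pot_star \<Phi> M, pot_star F M)"
    by (auto simp: pot_range_def)
  then obtain \<mu> where \<mu>: "\<And>k. \<mu> k \<in> invariant_measures X T"
    "\<And>k. p k = (pot_star \<Phi> (\<mu> k), pot_star F (\<mu> k))"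
    by metis
  obtain r M where r: "strict_mono (r :: nat \<Rightarrow> nat)" and M: "M \<in> invariant_measures X T"
    and lim: "\<And>f::'a \<Rightarrow> real. continuous_on X f \<Longrightarrow> (\<lambda>k. \<integral>x. f x \<partial>\<mu> (r k)) \<longlonglongrightarrow> (\<integral>x. f x \<partial>M)"
    by (rule invariant_measures_seq_compact[of \<mu>, OF \<mu>(1)]) blast
  have "(p \<circ> r) \<longlonglongrightarrow> (pot_star \<Phi> M, pot_star F M)"
    unfolding comp_def \<mu>(2)
    by (intro tendsto_Pair pot_star_weak_limit[OF _ \<mu>(1) M lim] assms)
  moreover have "(pot_star \<Phi> M, pot_star F M) \<in> pot_range \<Phi> F"
    using M by (auto simp: pot_range_def)
  ultimately show "\<exists>l\<in>pot_range \<Phi> F. \<exists>r. strict_mono r \<and> (p \<circ> r) \<longlonglongrightarrow> l"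
    using r by blast
qed

lemma convex_pot_range:
  assumes "AAP X T F" "AAP X T \<Phi>"
  shows "convex (pot_range \<Phi> F)"
proof (rule convexI)
  fix p q :: "real \<times> real" and u v :: real
  assume "p \<in> pot_range \<Phi> F" "q \<in> pot_range \<Phi> F" and uv: "0 \<le> u" "0 \<le> v" "u + v = 1"
  then obtain M N where M: "M \<in> invariant_measures X T" "p = (pot_star \<Phi> M, pot_star F M)"
    and N: "N \<in> invariant_measures X T" "q = (pot_star \<Phi> N, pot_star F N)"
    by (auto simp: pot_range_def)
  have v: "v = 1 - u" "u \<le> 1"
    using uv by auto
  obtain P where P: "P \<in> invariant_measures X T"
    "\<And>f::'a \<Rightarrow> real. continuous_on X f \<Longrightarrow>
      (\<integral>x. f x \<partial>P) = u * (\<integral>x. f x \<partial>M) + (1 - u) * (\<integral>x. f x \<partial>N)"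
    using invariant_measures_mixture[OF M(1) N(1) uv(1) v(2)] by blast
  have "u *\<^sub>R p + v *\<^sub>R q = (pot_star \<Phi> P, pot_star F P)"
    using pot_star_mixture[OF assms(1) M(1) N(1) P] pot_star_mixture[OF assms(2) M(1) N(1) P]
    by (simp add: M N v)
  then show "u *\<^sub>R p + v *\<^sub>R q \<in> pot_range \<Phi> F"
    using P(1) by (auto simp: pot_range_def)
qed

end

section \<open>The upper boundary of a compact convex planar set\<close>

text \<open>Vertical slices of a compact set are compact, so the supremum is attained. Restricting
  to the projection keeps the slice nonempty, without which \<open>Sup\<close> would be
  unspecified.\<close>

lemma upper_boundary_max:
  fixes K :: "(real \<times> real) set"
  assumes "compact K" "a \<in> fst ` K"
  shows "(a, Sup {y. (a, y) \<in> K}) \<in> K" "\<And>y. (a, y) \<in> K \<Longrightarrow> y \<le> Sup {y. (a, y) \<in> K}"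
proof -
  have eq: "{y. (a, y) \<in> K} = snd ` (K \<inter> {a} \<times> UNIV)"
    by force
  have "compact (K \<inter> {a} \<times> UNIV)"
    using assms(1) by (intro compact_Int_closed closed_Times) auto
  then have *: "compact {y. (a, y) \<in> K}"
    unfolding eq by (intro compact_continuous_image continuous_intros)
  moreover have "{y. (a, y) \<in> K} \<noteq> {}"
    using assms(2) by force
  ultimately have "Sup {y. (a, y) \<in> K} \<in> {y. (a, y) \<in> K}"
    by (intro closed_contains_Sup) (auto intro: compact_imp_closed bounded_imp_bdd_above compact_imp_bounded)
  then show "(a, Sup {y. (a, y) \<in> K}) \<in> K"
    by simp
  show "y \<le> Sup {y. (a, y) \<in> K}" if "(a, y) \<in> K" for y
    using that * by (intro cSup_upper) (auto intro: bounded_imp_bdd_above compact_imp_bounded)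
qed

text \<open>Convexity of \<open>K\<close> makes the boundary function concave, but a concave
  function may still jump down at an end point of its interval; compactness of \<open>K\<close>
  excludes this.\<close>

lemma continuous_on_upper_boundary:
  fixes K :: "(real \<times> real) set"
  assumes K: "compact K" "convex K"
  shows "continuous_on (fst ` K) (\<lambda>a. Sup {y. (a, y) \<in> K})"
proof (cases "K = {}")
  case False
  define S where "S = fst ` K"
  define h where "h a = Sup {y. (a, y) \<in> K}" for a
  note h = upper_boundary_max[OF K(1), folded S_def h_def]
  have "compact S"
    unfolding S_def using K(1) by (intro compact_continuous_image continuous_intros)
  then obtain lo hi where S: "lo \<in> S" "hi \<in> S" "\<And>x. x \<in> S \<Longrightarrow> lo \<le> x" "\<And>x. x \<in> S \<Longrightarrow> x \<le> hi"
    using compact_attains_inf[of S] compact_attains_sup[of S] False by (auto simp: S_def)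
  have "(h \<longlongrightarrow> h a) (at a within S)" if a: "a \<in> S" for a
  proof (rule order_tendstoI)
    fix c assume c: "h a < c"
    \<comment> \<open>The superlevel set of \<open>h\<close> at \<open>c\<close> is the projection
      of the part of \<open>K\<close> in a closed half-plane, hence compact, because the maximum
      over each slice is attained. Upper semicontinuity follows from its closedness.\<close>
    have ge_iff: "x \<in> fst ` (K \<inter> UNIV \<times> {c..}) \<longleftrightarrow> x \<in> S \<and> c \<le> h x" for x
    proof
      assume "x \<in> fst ` (K \<inter> UNIV \<times> {c..})"
      then show "x \<in> S \<and> c \<le> h x"
        using h(2)[of x] by (force simp: S_def)
    qed (use h(1)[of x] in force)
    have "compact (K \<inter> UNIV \<times> {c..})"
      using K(1) by (intro compact_Int_closed closed_Times) auto
    then have "compact (fst ` (K \<inter> UNIV \<times> {c..}))"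
      by (intro compact_continuous_image continuous_intros)
    then have "open (- (fst ` (K \<inter> UNIV \<times> {c..})))"
      by (intro open_Compl compact_imp_closed)
    moreover have "a \<in> - (fst ` (K \<inter> UNIV \<times> {c..}))"
      using c ge_iff[of a] by auto
    ultimately show "\<forall>\<^sub>F x in at a within S. h x < c"
      unfolding eventually_at_topological using ge_iff by (metis ComplD not_le)
  next
    fix c assume c: "c < h a"
    \<comment> \<open>For \<^term>\<open>b = a\<close> division by zero makes this chord constant.\<close>
    define l where "l b x = h a + (x - a) / (b - a) * (h b - h a)" for b x
    \<comment> \<open>The chord from \<open>(a, h a)\<close> to \<open>(b, h b)\<close> stays in
      \<open>K\<close> by convexity and therefore below the upper boundary.\<close>
    have l_le: "l b x \<le> h x" if b: "b \<in> S" and x: "a \<le> x \<and> x \<le> b \<or> b \<le> x \<and> x \<le> a" for b x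
    proof (cases "b = a")
      case True
      then show ?thesis
        using x by (auto simp: l_def)
    next
      case False
      define t where "t = (x - a) / (b - a)"
      have t: "0 \<le> t" "t \<le> 1"
        using x False by (auto simp: t_def divide_simps)
      have "(1 - t) *\<^sub>R (a, h a) + t *\<^sub>R (b, h b) \<in> K"
        using t h(1)[OF a] h(1)[OF b] by (intro convexD[OF K(2)]) auto
      moreover have "(1 - t) * a + t * b = a + t * (b - a)"
        by (simp add: algebra_simps)
      moreover have "t * (b - a) = x - a"
        using False by (simp add: t_def)
      ultimately have "(x, (1 - t) * h a + t * h b) \<in> K"
        by simp
      moreover have "x \<in> S"
        using \<open>(x, (1 - t) * h a + t * h b) \<in> K\<close> by (force simp: S_def)
      ultimately have "(1 - t) * h a + t * h b \<le> h x"
        using h(2) by blast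
      then show ?thesis
        by (simp add: l_def t_def[symmetric] algebra_simps)
    qed
    \<comment> \<open>Each chord is continuous in \<open>x\<close> and takes the value
      \<open>h a\<close> at \<open>a\<close>.\<close>
    have "\<forall>\<^sub>F x in at a within S. c < l b x" for b
    proof (rule order_tendstoD)
      have "(l b \<longlongrightarrow> l b a) (at a within S)"
        unfolding l_def divide_inverse by (intro tendsto_intros)
      then show "(l b \<longlongrightarrow> h a) (at a within S)"
        by (simp add: l_def)
    qed (rule c)
    then have "\<forall>\<^sub>F x in at a within S. c < l lo x" "\<forall>\<^sub>F x in at a within S. c < l hi x"
      by blast+
    moreover have "\<forall>\<^sub>F x in at a within S. x \<in> S"
      by (simp add: eventually_at_filter)
    \<comment> \<open>A point \<open>x\<close> of \<open>S\<close> lies between \<open>lo\<close>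
      and \<open>a\<close> or between \<open>a\<close> and \<open>hi\<close>, so one of the two
      chords bounds \<open>h x\<close> from below.\<close>
    ultimately show "\<forall>\<^sub>F x in at a within S. c < h x"
    proof eventually_elim
      case (elim x)
      then show ?case
        using l_le[OF S(1), of x] l_le[OF S(2), of x] S(3,4)[of x] by linarith
    qed
  qed
  then show ?thesis
    unfolding continuous_on_def h_def S_def by blast
qed simp

section \<open>Transfer from the planar set to the conditional maximum\<close>

theorem theoremA:
  fixes X :: "'a::metric_space set" and T :: "'a \<Rightarrow> 'a"
    and F \<Phi> :: "nat \<Rightarrow> 'a \<Rightarrow> real"
  assumes "compact X" and "X \<noteq> {}"
    and "continuous_on X T" and "T ` X \<subseteq> X"
    and "AAP X T F" and "AAP X T \<Phi>"
  shows "continuous_on {eta_pot X T \<Phi> .. beta_pot X T \<Phi>} (cond_max_avg X T F \<Phi>)"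
proof -
  interpret compact_system X T
    using assms by unfold_locales
  define K where "K = pot_range \<Phi> F"
  have K: "compact K" "convex K"
    unfolding K_def using compact_pot_range[OF assms(5,6)] convex_pot_range[OF assms(5,6)] by auto
  have fst_K: "fst ` K = pot_star \<Phi> ` invariant_measures X T"
    unfolding K_def pot_range_def by (simp add: image_image)
  \<comment> \<open>Level sets of \<open>\<Phi>\<close> correspond to vertical slices, so the
    conditional maximum is the upper boundary function of \<open>K\<close>.\<close>
  have "pot_star F ` level_measures X T \<Phi> \<alpha> = {y. (\<alpha>, y) \<in> K}" for \<alpha>
    unfolding K_def pot_range_def level_measures_def by auto
  then have cond: "cond_max_avg X T F \<Phi> = (\<lambda>\<alpha>. Sup {y. (\<alpha>, y) \<in> K})"
    by (simp add: cond_max_avg_def fun_eq_iff)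
  show ?thesis
  proof (cases "K = {}")
    \<comment> \<open>By Krylov-Bogolyubov this case is void; the unspecified \<^term>\<open>Sup {} :: real\<close> spares proving it.\<close>
    case True
    then show ?thesis
      by (simp add: cond)
  next
    case False
    have "compact (fst ` K)"
      using K(1) by (intro compact_continuous_image continuous_intros)
    \<comment> \<open>The extreme levels are attained by compactness. As the projection is also
      convex, every level between them is attained, so all slices over the interval are
      nonempty.\<close>
    then have "Inf (fst ` K) \<in> fst ` K" "Sup (fst ` K) \<in> fst ` K"
      using False by (auto intro!: closed_contains_Inf closed_contains_Sup compact_imp_closed
          bounded_imp_bdd_above bounded_imp_bdd_below compact_imp_bounded simp del: image_is_empty)
    moreover have "is_interval (fst ` K)"
      using convex_linear_image[OF linear_fst K(2)] by (simp add: is_interval_convex_1)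
    ultimately have "{eta_pot X T \<Phi> .. beta_pot X T \<Phi>} \<subseteq> fst ` K"
      unfolding eta_pot_def beta_pot_def fst_K[symmetric] by (auto intro: mem_is_interval_1_I)
    then show ?thesis
      unfolding cond using continuous_on_upper_boundary[OF K] continuous_on_subset by blast
  qed
qed

end
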